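(* For every integer $\ell>1$ there exists $\varepsilon>0$ such that, with high probability (i.e. with probability tending to $1$ as $n\to\infty$), the random graph $G_{n,p}$ with $p=\frac{1+\varepsilon}{n}$ either has odd-girth less than $2\ell+1$ or admits a graph homomorphism to the cycle $C_{2\ell+1}$.
   Context: $G_{n,p}$ is the Erdős–Rényi random graph on vertex set $\{1,\dots,n\}$ in which each pair of vertices is joined independently with probability $p$. The odd-girth of a graph is the length of its shortest odd cycle (infinite if the graph is bipartite). A homomorphism from $G$ to $H$ is a map $f:V(G)\to V(H)$ such that $xy\in E(G)$ implies $f(x)f(y)\in E(H)$. $C_{2\ell+1}$ denotes the cycle on $2\ell+1$ vertices. *)

theory Defs
  imports "HOL-Probability.Probability" "HOL-Library.Extended_Nat"
begin

text \<open>
  A simple graph is represented by a pair of a vertex set and a set of edges, each edge being a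
  two-element set of vertices. The type itself does not enforce the latter condition.
\<close>

type_synonym 'a graph = "'a set \<times> 'a set set"

abbreviation (input) verts :: "'a graph \<Rightarrow> 'a set" where "verts \<equiv> fst"

abbreviation (input) edges :: "'a graph \<Rightarrow> 'a set set" where "edges \<equiv> snd"

definition vertex_pairs :: "'a set \<Rightarrow> 'a set set" where
  "vertex_pairs V = {e. e \<subseteq> V \<and> card e = 2}"

text \<open>
  A cycle is given by the list of its distinct vertices in cyclic order; the closing edge joins
  the last entry to the first. Its length is the length of the list.
\<close>

definition is_cycle :: "'a graph \<Rightarrow> 'a list \<Rightarrow> bool" where
  "is_cycle G c \<longleftrightarrow> 3 \<le> length c \<and> distinct c \<and> set c \<subseteq> verts G \<and>
     (\<forall>i<length c. {c ! i, c ! (Suc i mod length c)} \<in> edges G)"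

text \<open>The infimum of the empty set in \<^typ>\<open>enat\<close> is \<open>\<infinity>\<close>, the value for bipartite graphs.\<close>

definition odd_girth :: "'a graph \<Rightarrow> enat" where
  "odd_girth G = (INF c \<in> {c. is_cycle G c \<and> odd (length c)}. enat (length c))"

definition graph_hom :: "'a graph \<Rightarrow> 'b graph \<Rightarrow> ('a \<Rightarrow> 'b) \<Rightarrow> bool" where
  "graph_hom G H f \<longleftrightarrow> f ` verts G \<subseteq> verts H \<and>
     (\<forall>x\<in>verts G. \<forall>y\<in>verts G. {x, y} \<in> edges G \<longrightarrow> {f x, f y} \<in> edges H)"

text \<open>The cycle on \<open>k\<close> vertices; it is a simple graph only for \<open>k \<ge> 3\<close>.\<close>

definition cycle_graph :: "nat \<Rightarrow> nat graph" where
  "cycle_graph k = ({..<k}, {{i, Suc i mod k} | i. i < k})"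

text \<open>
  Each pair is kept independently with probability \<open>p\<close>. Note that
  \<^const>\<open>bernoulli_pmf\<close> truncates its parameter to the interval from 0 to 1.
\<close>

definition erdos_renyi :: "nat \<Rightarrow> real \<Rightarrow> nat graph pmf" where
  "erdos_renyi n p =
     map_pmf (\<lambda>b. ({1..n}, {e \<in> vertex_pairs {1..n}. b e}))
       (Pi_pmf (vertex_pairs {1..n}) False (\<lambda>_. bernoulli_pmf p))"

end

theory Submission
  imports Defs
begin

text \<open>
  Let \<open>M = 3 \<cdot> 9\<^sup>l\<close>. If \<open>G\<close> has no odd cycle shorter than \<open>2 l + 1\<close> and no homomorphism to the cycle
  of that length, take an inclusion-minimal vertex set \<open>S\<close> spanning a graph \<open>(S, T)\<close> without
  homomorphism. It has minimum degree at least 2, and any ear of length \<open>2 l\<close>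
  could be deleted and recoloured, since any two vertices of the target cycle are joined by a
  walk of length \<open>2 l\<close>. Hence every vertex is close to one of degree at least 3, which gives
  \<open>|T| \<ge> (1 + 1/M) |S|\<close>.

  With high probability no such \<open>(S, T)\<close> exists in \<open>G\<^sub>n\<^sub>,\<^sub>p\<close>. For \<open>|S| \<le> c n\<close> a union bound suffices. For larger
  \<open>S\<close>, choose \<open>\<theta> < 1\<close> with \<open>n p \<theta> < 1\<close> and \<open>\<theta> (1 + 1/M) > 1\<close>. Keeping each edge of \<open>T\<close>
  with probability \<open>\<theta>\<close> and then removing one edge from each surviving cycle leaves a forest, so
  \<open>\<theta> |T| \<le> |S| + W\<close>, where \<open>W\<close> is the sum of \<open>\<theta>\<close> to the length over the cycles of \<open>G\<close>. The
  expectation of \<open>W\<close> is bounded by the geometric series in \<open>n p \<theta>\<close>, whereas a dense \<open>(S, T)\<close> makes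
  \<open>W\<close> linear in \<open>n\<close>; Markov's inequality concludes.
\<close>

subsection \<open>Cycles and edge counts\<close>

definition cycle_edges :: "'a list \<Rightarrow> 'a set set" where
  "cycle_edges c = (\<lambda>i. {c ! i, c ! (Suc i mod length c)}) ` {..<length c}"

lemma is_cycle_iff:
  "is_cycle (V, E) c \<longleftrightarrow> 3 \<le> length c \<and> distinct c \<and> set c \<subseteq> V \<and> cycle_edges c \<subseteq> E"
  by (auto simp: is_cycle_def cycle_edges_def)

text \<open>Two positions could give the same pair only if each were the cyclic successor of the
  other, which happens only for length 2.\<close>

lemma card_cycle_edges:
  assumes "distinct c" "3 \<le> length c"
  shows "card (cycle_edges c) = length c"
proof -
  let ?n = "length c"
  have "inj_on (\<lambda>i. {c ! i, c ! (Suc i mod ?n)}) {..<?n}"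
  proof (rule inj_onI)
    fix i j assume ij: "i \<in> {..<?n}" "j \<in> {..<?n}"
      and eq: "{c ! i, c ! (Suc i mod ?n)} = {c ! j, c ! (Suc j mod ?n)}"
    have lt: "Suc i mod ?n < ?n" "Suc j mod ?n < ?n"
      using assms(2) by (auto intro!: mod_less_divisor simp del: length_greater_0_conv)
    from eq have "i = j \<or> (i = Suc j mod ?n \<and> j = Suc i mod ?n)"
      using ij lt assms(1) by (auto simp: doubleton_eq_iff nth_eq_iff_index_eq)
    moreover have "\<not> (i = Suc j mod ?n \<and> j = Suc i mod ?n)"
      using ij assms(2) by (auto simp: mod_Suc split: if_splits)
    ultimately show "i = j" by blast
  qed
  then show ?thesis by (simp add: cycle_edges_def card_image)
qed

section \<open>Edges as pairs, and cycles closed by walks\<close>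

lemma pair_in_vertex_pairsD:
  assumes "T \<subseteq> vertex_pairs S" "{x, y} \<in> T"
  shows "x \<in> S" "y \<in> S" "x \<noteq> y"
  using assms by (auto simp: vertex_pairs_def card_insert_if split: if_splits)

lemma finite_vertex_pairs: "finite V \<Longrightarrow> finite (vertex_pairs V)"
  by (rule finite_subset[of _ "Pow V"]) (auto simp: vertex_pairs_def)

text \<open>With two neighbours available at every vertex, the walk can always leave by an edge
  other than the one it arrived by.\<close>

lemma nonbacktracking_walk:
  assumes "v \<in> S" "T \<subseteq> vertex_pairs S"
    and two: "\<And>x. x \<in> S \<Longrightarrow> \<exists>y z. y \<noteq> z \<and> {x, y} \<in> T \<and> {x, z} \<in> T"
  obtains w :: "nat \<Rightarrow> 'a" where "w 0 = v" "\<And>i. w i \<in> S" "\<And>i. {w i, w (Suc i)} \<in> T"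
    "\<And>i. w (Suc (Suc i)) \<noteq> w i"
proof -
  \<comment> \<open>The state of the recursion is a directed edge rather than a vertex, so that the
    previous vertex is remembered.\<close>
  have "\<exists>f. \<forall>n. ({fst (f n), snd (f n)} \<in> T \<and> (n = 0 \<longrightarrow> fst (f n) = v)) \<and>
     (fst (f (Suc n)) = snd (f n) \<and> snd (f (Suc n)) \<noteq> fst (f n))"
  proof (rule dependent_nat_choice)
    show "\<exists>p. {fst p, snd p} \<in> T \<and> ((0::nat) = 0 \<longrightarrow> fst p = v)"
      using two[OF assms(1)] by auto
  next
    fix p and n :: nat assume "{fst p, snd p} \<in> T \<and> (n = 0 \<longrightarrow> fst p = v)"
    then have "snd p \<in> S" using pair_in_vertex_pairsD(2)[OF assms(2)] by blast
    from two[OF this] obtain y where "{snd p, y} \<in> T" "y \<noteq> fst p" by metis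
    then show "\<exists>q. ({fst q, snd q} \<in> T \<and> (Suc n = 0 \<longrightarrow> fst q = v)) \<and>
        fst q = snd p \<and> snd q \<noteq> fst p"
      by (intro exI[of _ "(snd p, y)"]) auto
  qed
  then obtain f where f: "\<And>n. {fst (f n), snd (f n)} \<in> T" "fst (f 0) = v"
    "\<And>n. fst (f (Suc n)) = snd (f n)" "\<And>n. snd (f (Suc n)) \<noteq> fst (f n)" by blast
  show thesis
  proof
    show "(\<lambda>n. fst (f n)) 0 = v" by (simp add: f)
    show "{fst (f i), fst (f (Suc i))} \<in> T" for i using f by simp
    show "fst (f i) \<in> S" for i using pair_in_vertex_pairsD(1)[OF assms(2) f(1)] .
    show "fst (f (Suc (Suc i))) \<noteq> fst (f i)" for i using f(3)[of "Suc i"] f(4)[of i] by simp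
  qed
qed

text \<open>Take the least \<open>j\<close> whose value has occurred before; minimality makes
  \<open>w\<close> injective below \<open>j\<close>.\<close>

lemma first_repetition:
  fixes w :: "nat \<Rightarrow> 'a"
  assumes "\<not> inj_on w {..m}"
  obtains i j where "i < j" "j \<le> m" "w i = w j" "inj_on w {..<j}"
proof -
  define P where "P j \<longleftrightarrow> (\<exists>i<j. w i = w j)" for j
  from assms obtain a b where ab: "a \<le> m" "b \<le> m" "w a = w b" "a \<noteq> b"
    by (auto simp: inj_on_def)
  then have "P (max a b)" unfolding P_def
    by (cases "a < b") (auto intro: exI[of _ "min a b"] simp: max_def min_def)
  define j where "j = (LEAST j. P j)"
  have "P j" "j \<le> max a b" unfolding j_def
    using \<open>P (max a b)\<close> by (auto intro: LeastI Least_le)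
  have "inj_on w {..<j}"
  proof (rule linorder_inj_onI)
    fix x y assume "x < y" "y \<in> {..<j}"
    moreover from this have "\<not> P y" unfolding j_def using not_less_Least by auto
    ultimately show "w x \<noteq> w y" unfolding P_def by auto
  qed auto
  with \<open>P j\<close> \<open>j \<le> max a b\<close> ab that show thesis unfolding P_def by auto
qed

text \<open>The absence of loops excludes \<open>j = i + 1\<close> and non-backtracking excludes
  \<open>j = i + 2\<close>, so the closed segment has length at least 3.\<close>

lemma is_cycle_walk:
  assumes "T \<subseteq> vertex_pairs S" and w: "\<And>i. w i \<in> S" "\<And>i. {w i, w (Suc i)} \<in> T"
    "\<And>i. w (Suc (Suc i)) \<noteq> w i" and "i < j" "w i = w j" "inj_on w {..<j}"
  shows "is_cycle (S, T) (map w [i..<j])"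
  unfolding is_cycle_def
proof (intro conjI allI impI)
  have "j \<noteq> Suc i" using w(2)[of i] pair_in_vertex_pairsD(3)[OF assms(1)] assms(6) by metis
  moreover have "j \<noteq> Suc (Suc i)" using w(3)[of i] assms(6) by metis
  ultimately show "3 \<le> length (map w [i..<j])" using assms(5) by auto
  show "distinct (map w [i..<j])" using assms(7) by (auto simp: distinct_map inj_on_def)
  show "set (map w [i..<j]) \<subseteq> verts (S, T)" using w(1) by auto
  fix k assume k: "k < length (map w [i..<j])"
  show "{map w [i..<j] ! k, map w [i..<j] ! (Suc k mod length (map w [i..<j]))} \<in> edges (S, T)"
  proof (cases "Suc k < j - i")
    case True
    then show ?thesis using w(2)[of "i + k"] by simp
  next
    case False
    then have *: "Suc k = j - i" using k by simp
    then have "Suc (i + k) = j" using assms(5) by linarith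
    then have "w (Suc (i + k)) = w i" using assms(6) by simp
    then show ?thesis using w(2)[of "i + k"] * by (simp add: k)
  qed
qed

text \<open>A vertex with at most one neighbour can be removed at the cost of at most one edge. If
  there is none and \<open>S\<close> is nonempty, a non-backtracking walk must repeat a vertex and
  closes a cycle.\<close>

lemma acyclic_card_edges_le:
  assumes "finite S" "T \<subseteq> vertex_pairs S" "\<And>c. \<not> is_cycle (S, T) c"
  shows "card T \<le> card S"
  using assms
proof (induction "card S" arbitrary: S T rule: less_induct)
  case less
  have finT: "finite T" using finite_subset[OF less(3) finite_vertex_pairs[OF less(2)]] .
  show ?case
  proof (cases "\<forall>x\<in>S. \<exists>y z. y \<noteq> z \<and> {x, y} \<in> T \<and> {x, z} \<in> T")
    case True
    show ?thesis
    proof (cases "S = {}")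
      case True
      then have "T = {}" using less(3) by (auto simp: vertex_pairs_def)
      then show ?thesis by simp
    next
      case False
      then obtain v where "v \<in> S" by auto
      from nonbacktracking_walk[OF this less(3)] True obtain w :: "nat \<Rightarrow> 'a"
        where w: "\<And>i. w i \<in> S" "\<And>i. {w i, w (Suc i)} \<in> T" "\<And>i. w (Suc (Suc i)) \<noteq> w i"
        by metis
      have "\<not> inj_on w {..card S}"
      proof
        assume "inj_on w {..card S}"
        then have "card {..card S} \<le> card S"
          by (rule card_inj_on_le) (use w(1) less(2) in auto)
        then show False by simp
      qed
      then obtain i j where "i < j" "w i = w j" "inj_on w {..<j}" by (rule first_repetition)
      then have "is_cycle (S, T) (map w [i..<j])" by (intro is_cycle_walk less(3) w)
      then show ?thesis using less(4) by blast
    qed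
  next
    case False
    then obtain x where x: "x \<in> S" and one: "\<And>y z. {x, y} \<in> T \<Longrightarrow> {x, z} \<in> T \<Longrightarrow> y = z"
      by blast
    define T' where "T' = {e \<in> T. x \<notin> e}"
    have T': "T' \<subseteq> vertex_pairs (S - {x})" using less(3) unfolding T'_def vertex_pairs_def by auto
    have sub: "T' \<subseteq> T" by (auto simp: T'_def)
    have "card T' \<le> card (S - {x})"
    proof (rule less(1))
      show "card (S - {x}) < card S" using x less(2) by (rule card_Diff1_less[rotated])
      show "\<not> is_cycle (S - {x}, T') c" for c
        using less(4)[of c] sub by (auto simp: is_cycle_iff)
    qed (use less(2) T' in auto)
    moreover have "card (T - T') \<le> 1"
    proof -
      have "e = f" if "e \<in> T - T'" "f \<in> T - T'" for e f
      proof -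
        have "\<exists>y. e = {x, y}" if "e \<in> T - T'" for e
        proof -
          have "x \<in> e" "card e = 2" using that less(3) by (auto simp: T'_def vertex_pairs_def)
          then show ?thesis by (auto simp: card_2_iff)
        qed
        from this[OF that(1)] this[OF that(2)] obtain y z where "e = {x, y}" "f = {x, z}" by blast
        then show ?thesis using one[of y z] that by auto
      qed
      then show ?thesis using card_le_Suc0_iff_eq[of "T - T'"] finT by auto
    qed
    moreover have "card T = card T' + card (T - T')"
      using card_Diff_subset[of T' T] card_mono[OF finT sub] finite_subset[OF sub finT] sub by simp
    moreover have "card S = Suc (card (S - {x}))" by (rule card.remove[OF less(2) x])
    ultimately show ?thesis by linarith
  qed
qed

text \<open>Deleting an edge of a cycle destroys at least that cycle, so the count of cycles pays
  for every edge deleted before the graph is acyclic. \<open>C\<close> may be any finite set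
  containing the cycles, so that one \<open>C\<close> serves all subgraphs.\<close>

lemma card_edges_le_cycles:
  assumes "finite S" "T \<subseteq> vertex_pairs S" "finite C" "\<And>c. is_cycle (S, T) c \<Longrightarrow> c \<in> C"
  shows "card T \<le> card S + card {c \<in> C. cycle_edges c \<subseteq> T}"
  using assms(2,4)
proof (induction "card T" arbitrary: T rule: less_induct)
  case less
  have finT: "finite T" using finite_subset[OF less(2) finite_vertex_pairs[OF assms(1)]] .
  show ?case
  proof (cases "\<exists>c. is_cycle (S, T) c")
    case False
    then show ?thesis using acyclic_card_edges_le[OF assms(1) less(2)] by fastforce
  next
    case True
    then obtain c where c: "is_cycle (S, T) c" by auto
    then have "cycle_edges c \<subseteq> T" "c \<in> C" "card (cycle_edges c) \<ge> 3"
      using less(3) by (auto simp: is_cycle_iff card_cycle_edges)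
    moreover from this have "cycle_edges c \<noteq> {}" by force
    ultimately obtain e where e: "e \<in> cycle_edges c" "e \<in> T" by auto
    have lt: "card (T - {e}) < card T" using card_Diff1_less[OF finT e(2)] .
    have "card (T - {e}) \<le> card S + card {c \<in> C. cycle_edges c \<subseteq> T - {e}}"
      by (rule less(1)[OF lt]) (use less(2,3) in \<open>auto simp: is_cycle_iff\<close>)
    moreover have "card {c \<in> C. cycle_edges c \<subseteq> T - {e}} < card {c \<in> C. cycle_edges c \<subseteq> T}"
    proof (rule psubset_card_mono)
      show "{c \<in> C. cycle_edges c \<subseteq> T - {e}} \<subset> {c \<in> C. cycle_edges c \<subseteq> T}"
        using e \<open>c \<in> C\<close> \<open>cycle_edges c \<subseteq> T\<close> by blast
    qed (use assms(3) in auto)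
    moreover have "card (T - {e}) = card T - 1" using e finT by simp
    ultimately show ?thesis by linarith
  qed
qed

text \<open>The left-hand side is affine in each coordinate of the vector of edge weights that is 1
  on \<open>F\<close> and \<open>\<theta>\<close> on \<open>U\<close>, so it suffices to bound it at 0/1 vectors.\<close>

lemma multiaffine_bound:
  fixes \<theta> s :: real and h :: "'c \<Rightarrow> 'e set"
  assumes "finite U" "finite C" "0 \<le> \<theta>" "\<theta> \<le> 1" "finite F" "F \<inter> U = {}"
    and "\<And>A. A \<subseteq> U \<Longrightarrow> real (card (F \<union> A)) - real (card {c \<in> C. h c \<subseteq> F \<union> A}) \<le> s"
  shows "real (card F) + \<theta> * real (card U) - (\<Sum>c\<in>{c \<in> C. h c \<subseteq> F \<union> U}. \<theta> ^ card (h c \<inter> U)) \<le> s"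
  using assms(1,5,6,7)
proof (induction U arbitrary: F rule: finite_induct)
  case empty
  show ?case using empty(3)[of "{}"] by simp
next
  case (insert e U)
  let ?g = "\<lambda>F U. real (card F) + \<theta> * real (card U)
    - (\<Sum>c\<in>{c \<in> C. h c \<subseteq> F \<union> U}. \<theta> ^ card (h c \<inter> U))"
  have A: "?g F U \<le> s" by (rule insert.IH) (use insert.prems in auto)
  have B: "?g (insert e F) U \<le> s"
  proof (rule insert.IH)
    fix A assume "A \<subseteq> U"
    then show "real (card (insert e F \<union> A)) - real (card {c \<in> C. h c \<subseteq> insert e F \<union> A}) \<le> s"
      using insert.prems(3)[of "insert e A"] by auto
  qed (use insert in auto)
  \<comment> \<open>\<open>?X\<close> collects the sets that avoid \<open>e\<close>, and
    \<open>?Y\<close> those that contain it and so acquire a factor \<open>\<theta>\<close>.\<close>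
  let ?X = "{c \<in> C. h c \<subseteq> F \<union> U}" and ?Y = "{c \<in> C. h c \<subseteq> insert e F \<union> U \<and> e \<in> h c}"
  have split: "{c \<in> C. h c \<subseteq> insert e F \<union> U} = ?X \<union> ?Y" "{c \<in> C. h c \<subseteq> F \<union> insert e U} = ?X \<union> ?Y"
    by auto
  have disj: "?X \<inter> ?Y = {}" using insert by auto
  have fin: "finite ?X" "finite ?Y" using assms(2) by auto
  have 1: "(\<Sum>c\<in>?X. \<theta> ^ card (h c \<inter> insert e U)) = (\<Sum>c\<in>?X. \<theta> ^ card (h c \<inter> U))"
    using insert by (intro sum.cong refl arg_cong[where f = "\<lambda>A. \<theta> ^ card A"]) auto
  have 2: "(\<Sum>c\<in>?Y. \<theta> ^ card (h c \<inter> insert e U)) = \<theta> * (\<Sum>c\<in>?Y. \<theta> ^ card (h c \<inter> U))"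
    unfolding sum_distrib_left
  proof (rule sum.cong[OF refl])
    fix c assume "c \<in> ?Y"
    then have "h c \<inter> insert e U = insert e (h c \<inter> U)" by auto
    then show "\<theta> ^ card (h c \<inter> insert e U) = \<theta> * \<theta> ^ card (h c \<inter> U)"
      using insert(1,2) by simp
  qed
  \<comment> \<open>Interpolation in the weight of \<open>e\<close>: weight 1 moves \<open>e\<close>
    into \<open>F\<close>, weight 0 drops it.\<close>
  have "?g F (insert e U) = \<theta> * ?g (insert e F) U + (1 - \<theta>) * ?g F U"
    unfolding split sum.union_disjoint[OF fin disj] 1 2
    using insert(1,2) insert.prems(1,2) by (simp add: algebra_simps)
  also have "\<dots> \<le> \<theta> * s + (1 - \<theta>) * s"
    using A B assms(3,4) by (intro add_mono mult_left_mono) auto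
  finally show ?case by (simp add: algebra_simps)
qed

text \<open>This is the expectation of \<open>card_edges_le_cycles\<close> for a random subset of
  \<open>T\<close> keeping each edge with probability \<open>\<theta>\<close>, obtained without
  probability from \<open>multiaffine_bound\<close> with \<open>F\<close> empty.\<close>

lemma weighted_cycle_bound:
  fixes \<theta> :: real and S :: "'a set"
  assumes "finite S" "T \<subseteq> vertex_pairs S" "finite C" "\<And>c. is_cycle (S, T) c \<Longrightarrow> c \<in> C"
    and "0 \<le> \<theta>" "\<theta> \<le> 1"
  shows "\<theta> * real (card T) \<le> real (card S) + (\<Sum>c\<in>{c \<in> C. cycle_edges c \<subseteq> T}. \<theta> ^ card (cycle_edges c))"
proof -
  have finT: "finite T" using finite_subset[OF assms(2) finite_vertex_pairs[OF assms(1)]] .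
  have "real (card ({} :: 'a set set)) + \<theta> * real (card T) -
      (\<Sum>c\<in>{c \<in> C. cycle_edges c \<subseteq> {} \<union> T}. \<theta> ^ card (cycle_edges c \<inter> T)) \<le> real (card S)"
  proof (rule multiaffine_bound[OF finT assms(3,5,6)])
    fix A assume "A \<subseteq> T"
    then have "card A \<le> card S + card {c \<in> C. cycle_edges c \<subseteq> A}"
      using assms by (intro card_edges_le_cycles) (auto simp: is_cycle_iff)
    then show "real (card ({} \<union> A)) - real (card {c \<in> C. cycle_edges c \<subseteq> {} \<union> A}) \<le> real (card S)"
      by simp
  qed (use assms in auto)
  moreover have "(\<Sum>c\<in>{c \<in> C. cycle_edges c \<subseteq> T}. \<theta> ^ card (cycle_edges c \<inter> T)) =
      (\<Sum>c\<in>{c \<in> C. cycle_edges c \<subseteq> T}. \<theta> ^ card (cycle_edges c))"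
    by (intro sum.cong refl arg_cong[where f = "\<lambda>A. \<theta> ^ card A"]) auto
  ultimately show ?thesis by simp
qed

subsection \<open>Homomorphisms to an odd cycle\<close>

text \<open>The vertices of the target cycle are represented by integers modulo \<open>k\<close>, so that homomorphisms
  along a path are integer walks with steps \<open>\<plusminus>1\<close>.\<close>

definition cyclic_step :: "nat \<Rightarrow> int \<Rightarrow> int \<Rightarrow> bool" where
  "cyclic_step k a b \<longleftrightarrow> int k dvd a - b - 1 \<or> int k dvd a - b + 1"

definition cyclic_colouring :: "nat \<Rightarrow> 'a set \<Rightarrow> 'a set set \<Rightarrow> ('a \<Rightarrow> int) \<Rightarrow> bool" where
  "cyclic_colouring k S E f \<longleftrightarrow> (\<forall>x\<in>S. \<forall>y\<in>S. {x, y} \<in> E \<longrightarrow> cyclic_step k (f x) (f y))"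

lemma cyclic_step_sym: "cyclic_step k a b \<longleftrightarrow> cyclic_step k b a"
proof -
  have "int k dvd a - b - 1 \<longleftrightarrow> int k dvd b - a + 1"
    by (metis (no_types, lifting) dvd_minus_iff minus_diff_eq diff_diff_eq2 diff_add_eq add.commute)
  moreover have "int k dvd a - b + 1 \<longleftrightarrow> int k dvd b - a - 1"
    by (metis (no_types, lifting) dvd_minus_iff minus_diff_eq diff_diff_eq2 diff_add_eq add.commute)
  ultimately show ?thesis unfolding cyclic_step_def by blast
qed

lemma cyclic_step_cong:
  assumes "cyclic_step k a b" "int k dvd a' - a" "int k dvd b' - b"
  shows "cyclic_step k a' b'"
proof -
  have *: "a' - b' - 1 = (a - b - 1) + ((a' - a) - (b' - b))"
    "a' - b' + 1 = (a - b + 1) + ((a' - a) - (b' - b))" by auto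
  have "int k dvd (a' - a) - (b' - b)" using assms(2,3) by (rule dvd_diff)
  then show ?thesis using assms(1) unfolding cyclic_step_def * by (metis dvd_add)
qed

text \<open>After reduction modulo \<open>k\<close>, a step by one joins a vertex to its cyclic
  successor; a step in the other direction is the same with the ends exchanged.\<close>

lemma graph_hom_cycle_graph:
  assumes "0 < k" "cyclic_colouring k V E f"
  shows "graph_hom (V, E) (cycle_graph k) (\<lambda>x. nat (f x mod int k))"
  unfolding graph_hom_def
proof (intro conjI ballI impI)
  show "(\<lambda>x. nat (f x mod int k)) ` verts (V, E) \<subseteq> verts (cycle_graph k)"
    using assms(1) by (auto simp: cycle_graph_def nat_less_iff)
next
  have edge: "{nat (a mod int k), nat (b mod int k)} \<in> edges (cycle_graph k)"
    if "int k dvd a - b - 1" for a b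
  proof -
    have "a mod int k = (b + 1) mod int k" using that by (simp add: mod_eq_dvd_iff algebra_simps)
    also have "\<dots> = (b mod int k + 1) mod int k" by (simp add: mod_add_left_eq)
    also have "\<dots> = int (Suc (nat (b mod int k)) mod k)"
      using assms(1) by (simp add: zmod_int add.commute)
    finally have "nat (a mod int k) = Suc (nat (b mod int k)) mod k" by simp
    moreover have "nat (b mod int k) < k" using assms(1) by (simp add: nat_less_iff)
    ultimately show ?thesis unfolding cycle_graph_def by (auto simp: insert_commute)
  qed
  fix x y assume "x \<in> verts (V, E)" "y \<in> verts (V, E)" "{x, y} \<in> edges (V, E)"
  then have "cyclic_step k (f x) (f y)" using assms(2) by (auto simp: cyclic_colouring_def)
  then have "int k dvd f x - f y - 1 \<or> int k dvd f y - f x - 1"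
    using cyclic_step_sym unfolding cyclic_step_def
    by (metis add.commute diff_add_eq diff_diff_eq2 dvd_minus_iff minus_diff_eq)
  then show "{nat (f x mod int k), nat (f y mod int k)} \<in> edges (cycle_graph k)"
    using edge[of "f x" "f y"] edge[of "f y" "f x"] by (auto simp: insert_commute)
qed

text \<open>A sum of \<open>m\<close> signs attains every value of the parity of \<open>m\<close>
  and of modulus at most \<open>m\<close>.\<close>

lemma int_walk:
  fixes d :: int
  assumes "\<bar>d\<bar> \<le> int m" "even (int m - d)"
  shows "\<exists>g :: nat \<Rightarrow> int. g 0 = a \<and> g m = a + d \<and> (\<forall>i<m. \<bar>g (Suc i) - g i\<bar> = 1)"
  using assms
proof (induction m arbitrary: d)
  case 0
  then show ?case by (intro exI[of _ "\<lambda>_. a"]) auto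
next
  case (Suc m)
  \<comment> \<open>The last step leads from \<open>a + e\<close> to \<open>a + d\<close>. For
    \<open>d = 0\<close> parity forces \<open>m\<close> to be odd, so \<open>e = 1\<close> is within
    range.\<close>
  define e where "e = (if d > 0 then d - 1 else d + 1)"
  have "\<bar>e\<bar> \<le> int m" using Suc.prems unfolding e_def by (auto split: if_splits) presburger+
  moreover have "even (int m - e)" using Suc.prems unfolding e_def by (auto split: if_splits)
  ultimately obtain g :: "nat \<Rightarrow> int"
    where g: "g 0 = a" "g m = a + e" "\<forall>i<m. \<bar>g (Suc i) - g i\<bar> = 1" using Suc.IH by blast
  show ?case
    by (rule exI[of _ "g(Suc m := a + d)"]) (use g in \<open>auto simp: e_def less_Suc_eq\<close>)
qed

text \<open>Since \<open>k\<close> is odd, the displacements \<open>r\<close> and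
  \<open>r - k\<close> in the same residue class have opposite parities, so one of them suits
  \<open>m\<close>. A closed walk of even length just goes back and forth.\<close>

lemma cyclic_walk:
  assumes "k = 2 * l + 1" "m \<ge> 2 * l \<or> (a = b \<and> even m)"
  shows "\<exists>g :: nat \<Rightarrow> int. g 0 = a \<and> int k dvd g m - b \<and> (\<forall>i<m. cyclic_step k (g i) (g (Suc i)))"
proof -
  have "\<exists>d. int k dvd a + d - b \<and> \<bar>d\<bar> \<le> int m \<and> even (int m - d)"
  proof (cases "a = b \<and> even m")
    case True
    then show ?thesis by (intro exI[of _ 0]) auto
  next
    case False
    then have m: "m \<ge> 2 * l" using assms by auto
    define r where "r = (b - a) mod int k"
    have "0 \<le> r" "r < int k" using assms(1) by (simp_all add: r_def)
    have "int k dvd (b - a) - r" unfolding r_def by (simp add: dvd_minus_mod)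
    then have "int k dvd - ((b - a) - r)" by (subst dvd_minus_iff)
    then have r: "int k dvd a + r - b" by (simp add: algebra_simps)
    consider "even (int m - r)" | "odd (int m - r)" "r \<noteq> 0" | "odd (int m - r)" "r = 0" by blast
    then show ?thesis
    proof cases
      case 1
      then show ?thesis using r \<open>0 \<le> r\<close> \<open>r < int k\<close> m assms(1) by (intro exI[of _ r]) auto
    next
      case 2
      have "int k dvd a + r - b - int k" by (rule dvd_diff[OF r dvd_refl])
      then have "int k dvd a + (r - int k) - b" by (simp add: algebra_simps)
      then show ?thesis using 2 \<open>0 \<le> r\<close> \<open>r < int k\<close> m assms(1)
        by (intro exI[of _ "r - int k"]) auto
    next
      \<comment> \<open>Here \<open>r - k\<close> has modulus \<open>k\<close>, one more than
        \<open>2 * l\<close>; but \<open>m\<close> is odd, hence at least \<open>k\<close>, and the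
        walk can go once around.\<close>
      case 3
      then have "odd m" by simp
      then have "m \<noteq> 2 * l" by auto
      have "int k dvd a + r - b + int k" by (rule dvd_add[OF r dvd_refl])
      then have "int k dvd a + int k - b" using 3 by (simp add: algebra_simps)
      then show ?thesis using 3 \<open>m \<noteq> 2 * l\<close> m assms(1)
        by (intro exI[of _ "int k"]) auto
    qed
  qed
  then obtain d where d: "int k dvd a + d - b" "\<bar>d\<bar> \<le> int m" "even (int m - d)" by blast
  then obtain g :: "nat \<Rightarrow> int" where g: "g 0 = a" "g m = a + d" "\<forall>i<m. \<bar>g (Suc i) - g i\<bar> = 1"
    using int_walk by blast
  have "cyclic_step k (g i) (g (Suc i))" if "i < m" for i
  proof -
    have "\<bar>g (Suc i) - g i\<bar> = 1" using g(3) that by blast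
    then have "g i - g (Suc i) - 1 = 0 \<or> g i - g (Suc i) + 1 = 0" by linarith
    then show ?thesis unfolding cyclic_step_def by (metis dvd_0_right)
  qed
  then show ?thesis using g d by auto
qed

text \<open>The interior of an ear \<open>w\<^sub>0, \<dots>, w\<^sub>m\<close> can be coloured along a walk of length \<open>m\<close>
  in the target cycle between the colours of its ends.\<close>

lemma cyclic_colouring_extend_ear:
  assumes "k = 2 * l + 1" "m \<ge> 2 * l \<or> (w 0 = w m \<and> even m)"
    and inj: "inj_on w {0<..<m}" and ends: "w 0 \<notin> w ` {0<..<m}" "w m \<notin> w ` {0<..<m}"
    and nbrs: "\<And>i y. 0 < i \<Longrightarrow> i < m \<Longrightarrow> y \<in> S \<Longrightarrow> {w i, y} \<in> E \<Longrightarrow> y = w (i - 1) \<or> y = w (Suc i)"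
    and col: "cyclic_colouring k (S - w ` {0<..<m}) E f"
  shows "\<exists>f. cyclic_colouring k S E f"
proof -
  let ?I = "w ` {0<..<m}"
  obtain g :: "nat \<Rightarrow> int" where g: "g 0 = f (w 0)" "int k dvd g m - f (w m)"
      "\<And>i. i < m \<Longrightarrow> cyclic_step k (g i) (g (Suc i))"
    using cyclic_walk[OF assms(1), of m "f (w 0)" "f (w m)"] assms(2) by auto
  define f' where "f' x = (if x \<in> ?I then g (the_inv_into {0<..<m} w x) else f x)" for x
  have f'_inner: "f' (w i) = g i" if "0 < i" "i < m" for i
    using that inj by (auto simp: f'_def the_inv_into_f_f)
  \<comment> \<open>Only congruence is claimed, because at the end \<open>w m\<close> the walk meets
    the given colour merely modulo \<open>k\<close>.\<close>
  have f'_w: "int k dvd f' (w i) - g i" if "i \<le> m" for i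
  proof -
    consider "i = 0" | "0 < i" "i < m" | "i = m" using \<open>i \<le> m\<close> by linarith
    then show ?thesis
    proof cases
      case 3
      then have "f' (w i) - g i = - (g m - f (w m))" using ends by (simp add: f'_def)
      then show ?thesis using g(2) by (metis dvd_minus_iff)
    qed (use ends g f'_inner in \<open>auto simp: f'_def\<close>)
  qed
  have step: "cyclic_step k (f' (w i)) (f' y)" if i: "0 < i" "i < m" and y: "y \<in> S" "{w i, y} \<in> E" for i y
  proof -
    have "cyclic_step k (f' (w j)) (f' (w (Suc j)))" if "j < m" for j
      using cyclic_step_cong[OF g(3)[OF that] f'_w f'_w] that by simp
    from this[of i] this[of "i - 1"] nbrs[OF i y] i show ?thesis
      using cyclic_step_sym by (auto simp: Suc_diff_1)
  qed
  have "cyclic_step k (f' x) (f' y)" if xy: "x \<in> S" "y \<in> S" "{x, y} \<in> E" for x y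
  proof -
    consider "x \<in> ?I" | "y \<in> ?I" | "x \<notin> ?I" "y \<notin> ?I" by blast
    then show ?thesis
    proof cases
      case 1
      then show ?thesis using step xy by auto
    next
      case 2
      then have "cyclic_step k (f' y) (f' x)" using step[of _ x] xy by (auto simp: insert_commute)
      then show ?thesis by (subst cyclic_step_sym)
    next
      case 3
      then show ?thesis using col xy by (auto simp: cyclic_colouring_def f'_def)
    qed
  qed
  then show ?thesis by (auto simp: cyclic_colouring_def)
qed

section \<open>Double counting of vertex-edge incidences\<close>

lemma sum_degrees:
  assumes "finite S" "T \<subseteq> vertex_pairs S"
  shows "(\<Sum>x\<in>S. card {y. {x, y} \<in> T}) = 2 * card T"
proof -
  have finT: "finite T" using finite_subset[OF assms(2) finite_vertex_pairs[OF assms(1)]] .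
  have deg: "card {y. {x, y} \<in> T} = card {e \<in> T. x \<in> e}" for x
  proof (rule bij_betw_same_card)
    show "bij_betw (\<lambda>y. {x, y}) {y. {x, y} \<in> T} {e \<in> T. x \<in> e}"
    proof (rule bij_betwI')
      fix e assume e: "e \<in> {e \<in> T. x \<in> e}"
      then have "card e = 2" using assms(2) by (auto simp: vertex_pairs_def)
      then show "\<exists>y\<in>{y. {x, y} \<in> T}. e = {x, y}" using e by (auto simp: card_2_iff insert_commute)
    qed (auto simp: doubleton_eq_iff)
  qed
  have "(\<Sum>x\<in>S. card {e \<in> T. x \<in> e}) = (\<Sum>x\<in>S. \<Sum>e\<in>T. if x \<in> e then 1 else 0)"
    using finT by (simp add: sum.If_cases Int_def conj_commute)
  also have "\<dots> = (\<Sum>e\<in>T. \<Sum>x\<in>S. if x \<in> e then 1 else 0)" by (rule sum.swap)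
  also have "\<dots> = (\<Sum>e\<in>T. 2)"
  proof (rule sum.cong[OF refl])
    fix e assume "e \<in> T"
    then have "e \<subseteq> S" "card e = 2" using assms(2) by (auto simp: vertex_pairs_def)
    moreover from this have "{x \<in> S. x \<in> e} = e" by auto
    ultimately show "(\<Sum>x\<in>S. if x \<in> e then 1 else 0) = (2::nat)"
      using assms(1) by (simp add: sum.If_cases Int_def conj_commute)
  qed
  finally show ?thesis by (simp add: deg)
qed

subsection \<open>Density of critical graphs\<close>

text \<open>In a critical graph there is a non-backtracking walk from every vertex. If it met only vertices
  of degree 2 for \<open>2 l\<close> steps, it would contain an ear whose interior can be recoloured, so layer
  \<open>2 l\<close> is the whole vertex set.\<close>

primrec layer :: "'a set \<Rightarrow> 'a set set \<Rightarrow> nat \<Rightarrow> 'a set" where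
  "layer S T 0 = {x \<in> S. 3 \<le> card {y. {x, y} \<in> T}}"
| "layer S T (Suc i) = layer S T i \<union> {x \<in> S. card {y. {x, y} \<in> T} = 2 \<and> (\<exists>y\<in>layer S T i. {x, y} \<in> T)}"

lemma layer_mono: "i \<le> j \<Longrightarrow> layer S T i \<subseteq> layer S T j"
  by (rule lift_Suc_mono_le[of "layer S T"]) auto

lemma layer_subset: "layer S T i \<subseteq> S"
  by (induction i) auto

lemma finite_neighbours:
  assumes "finite S" "T \<subseteq> vertex_pairs S"
  shows "finite {y. {x, y} \<in> T}"
  by (rule finite_subset[OF _ assms(1)]) (use pair_in_vertex_pairsD(2)[OF assms(2)] in auto)

text \<open>Every new vertex is a neighbour of the old layer, so there are at most as many as the
  degree sum of that layer. Each has degree 2, hence the degree sum at most triples.\<close>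

lemma volume_layer_le:
  assumes "finite S" "T \<subseteq> vertex_pairs S"
  shows "(\<Sum>x\<in>layer S T i. card {y. {x, y} \<in> T}) \<le> 3 ^ i * (\<Sum>x\<in>layer S T 0. card {y. {x, y} \<in> T})"
proof (induction i)
  case (Suc i)
  let ?d = "\<lambda>x. card {y. {x, y} \<in> T}"
  define N where "N = {x \<in> S. ?d x = 2 \<and> (\<exists>y\<in>layer S T i. {x, y} \<in> T)}"
  have fin: "finite (layer S T i)" using finite_subset[OF layer_subset assms(1)] .
  have finN: "finite N" using assms(1) by (simp add: N_def)
  have "card N \<le> card (\<Union>y\<in>layer S T i. {x. {y, x} \<in> T})"
    by (rule card_mono) (use fin finite_neighbours[OF assms] in \<open>auto simp: N_def insert_commute\<close>)
  also have "\<dots> \<le> sum ?d (layer S T i)" by (rule card_UN_le[OF fin])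
  finally have "card N \<le> sum ?d (layer S T i)" .
  moreover have "sum ?d N = 2 * card N" by (simp add: N_def)
  moreover have "sum ?d (layer S T (Suc i)) \<le> sum ?d (layer S T i) + sum ?d N"
    using sum_Un_nat[OF fin finN, of ?d] by (simp add: N_def)
  ultimately have "sum ?d (layer S T (Suc i)) \<le> 3 * sum ?d (layer S T i)" by linarith
  then show ?case using Suc by simp
qed simp

text \<open>\<open>proper\<close> permits colouring what remains after deleting a vertex or the
  interior of an ear; \<open>odd_cycle\<close> makes every cycle shorter than \<open>k\<close> even,
  so that it can be folded.\<close>

locale critical_graph =
  fixes l k :: nat and S :: "'a set" and T :: "'a set set"
  assumes k: "k = 2 * l + 1" and l: "0 < l"
    and fin: "finite S" and T: "T \<subseteq> vertex_pairs S"
    and odd_cycle: "\<And>c. is_cycle (S, T) c \<Longrightarrow> odd (length c) \<Longrightarrow> k \<le> length c"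
    and uncolourable: "\<And>f. \<not> cyclic_colouring k S T f"
    and proper: "\<And>X. X \<subset> S \<Longrightarrow> \<exists>f. cyclic_colouring k X T f"
begin

text \<open>A vertex whose only possible neighbour is \<open>u\<close> could be deleted and then
  coloured one step away from \<open>u\<close>.\<close>

lemma two_neighbours:
  assumes "x \<in> S"
  shows "\<exists>y z. y \<noteq> z \<and> {x, y} \<in> T \<and> {x, z} \<in> T"
proof (rule ccontr)
  assume "\<not> ?thesis"
  \<comment> \<open>If \<open>x\<close> is isolated, \<open>u\<close> is arbitrary.\<close>
  then obtain u where u: "\<And>y. {x, y} \<in> T \<Longrightarrow> y = u" by metis
  obtain f where f: "cyclic_colouring k (S - {x}) T f" using proper[of "S - {x}"] assms by auto
  have "cyclic_colouring k S T (f(x := f u + 1))"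
    unfolding cyclic_colouring_def
  proof (intro ballI impI)
    fix a b assume ab: "a \<in> S" "b \<in> S" "{a, b} \<in> T"
    have "a \<noteq> b" using pair_in_vertex_pairsD(3)[OF T ab(3)] .
    consider "a = x" "b = u" | "b = x" "a = u" | "a \<noteq> x" "b \<noteq> x"
      using u ab(3) by (metis insert_commute)
    then show "cyclic_step k ((f(x := f u + 1)) a) ((f(x := f u + 1)) b)"
      by cases (use ab \<open>a \<noteq> b\<close> f in \<open>auto simp: cyclic_step_def cyclic_colouring_def\<close>)
  qed
  then show False using uncolourable by blast
qed

lemma degree_ge_2:
  assumes "x \<in> S"
  shows "2 \<le> card {y. {x, y} \<in> T}"
proof -
  from two_neighbours[OF assms] obtain y z where "y \<noteq> z" "{x, y} \<in> T" "{x, z} \<in> T" by blast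
  then show ?thesis using card_mono[OF finite_neighbours[OF fin T], of "{y, z}" x] by simp
qed

text \<open>The interior is nonempty as \<open>m \<ge> 2\<close>, so the rest is colourable by
  minimality, and the colouring would extend along the ear.\<close>

lemma no_ear:
  assumes "m \<ge> 2 * l \<or> (w 0 = w m \<and> even m)" "m \<ge> 2" "\<And>i. w i \<in> S"
    "inj_on w {0<..<m}" "w 0 \<notin> w ` {0<..<m}" "w m \<notin> w ` {0<..<m}"
    "\<And>i y. 0 < i \<Longrightarrow> i < m \<Longrightarrow> {w i, y} \<in> T \<Longrightarrow> y = w (i - 1) \<or> y = w (Suc i)"
  shows False
proof -
  have "w 1 \<in> w ` {0<..<m}" using assms(2) by auto
  then have "S - w ` {0<..<m} \<subset> S" using assms(3)[of 1] by blast
  then obtain f where "cyclic_colouring k (S - w ` {0<..<m}) T f" using proper by blast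
  then have "\<exists>f. cyclic_colouring k S T f"
    by (intro cyclic_colouring_extend_ear[OF k assms(1,4,5,6)] assms(7))
  then show False using uncolourable by blast
qed

lemma vertex_in_layer:
  assumes "v \<in> S"
  shows "v \<in> layer S T (2 * l)"
proof -
  let ?d = "\<lambda>x. card {y. {x, y} \<in> T}"
  obtain w :: "nat \<Rightarrow> 'a" where w0: "w 0 = v"
    and w: "\<And>i. w i \<in> S" "\<And>i. {w i, w (Suc i)} \<in> T" "\<And>i. w (Suc (Suc i)) \<noteq> w i"
    using nonbacktracking_walk[OF assms T two_neighbours] by metis
  show ?thesis
  proof (cases "\<exists>i\<le>2 * l. 3 \<le> ?d (w i)")
    case True
    define i where "i = (LEAST i. 3 \<le> ?d (w i))"
    have i: "3 \<le> ?d (w i)" "i \<le> 2 * l"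
      using True unfolding i_def by (auto intro: LeastI Least_le order_trans)
    have less: "?d (w j) = 2" if "j < i" for j
      using not_less_Least[of j "\<lambda>i. 3 \<le> ?d (w i)"] degree_ge_2[OF w(1)[of j]] that unfolding i_def by simp
    \<comment> \<open>Walking back from the first vertex of degree at least 3, each step costs one
      layer.\<close>
    have "w (i - j) \<in> layer S T j" if "j \<le> i" for j
      using that
    proof (induction j)
      case 0
      then show ?case using i w by simp
    next
      case (Suc j)
      then have "w (i - j) \<in> layer S T j" "i - j = Suc (i - Suc j)" by auto
      then show ?case using less[of "i - Suc j"] Suc.prems w(1)[of "i - Suc j"] w(2)[of "i - Suc j"]
        by auto
    qed
    from this[of i] have "v \<in> layer S T i" using w0 by simp
    then show ?thesis by (rule subsetD[OF layer_mono[OF i(2)]])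
  next
    case False
    then have d2: "?d (w i) = 2" if "i \<le> 2 * l" for i
    proof -
      have "\<not> 3 \<le> ?d (w i)" using False that by blast
      then show ?thesis using degree_ge_2[OF w(1)[of i]] by linarith
    qed
    have nbrs: "y = w (i - 1) \<or> y = w (Suc i)" if "0 < i" "i \<le> 2 * l" "{w i, y} \<in> T" for i y
    proof -
      have "{w (i - 1), w (Suc i)} \<subseteq> {y. {w i, y} \<in> T}"
        using w(2)[of "i - 1"] w(2)[of i] that(1) by (auto simp: insert_commute)
      moreover have "card {w (i - 1), w (Suc i)} = 2" using w(3)[of "i - 1"] that(1) by auto
      ultimately have "{w (i - 1), w (Suc i)} = {y. {w i, y} \<in> T}"
        using d2[OF that(2)] by (intro card_subset_eq finite_neighbours[OF fin T]) auto
      then show ?thesis using that(3) by blast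
    qed
    have False
    proof (cases "inj_on w {..2 * l}")
      case True
      show False
      proof (rule no_ear[of "2 * l" w])
        show "inj_on w {0<..<2 * l}" using True by (rule inj_on_subset) auto
        show "w 0 \<notin> w ` {0<..<2 * l}" "w (2 * l) \<notin> w ` {0<..<2 * l}"
          by (auto dest: inj_onD[OF True])
      qed (use l w nbrs in auto)
    next
      case False
      then obtain i j where ij: "i < j" "j \<le> 2 * l" "w i = w j" and inj: "inj_on w {..<j}"
        by (rule first_repetition)
      have cyc: "is_cycle (S, T) (map w [i..<j])" by (intro is_cycle_walk T w ij inj)
      then have ij3: "i + 3 \<le> j" by (auto simp: is_cycle_def)
      \<comment> \<open>The repetition must be at the start: otherwise \<open>w i\<close> would have
        the three distinct neighbours \<open>w (i - 1)\<close>, \<open>w (i + 1)\<close> and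
        \<open>w (j - 1)\<close>.\<close>
      have "i = 0"
      proof (rule ccontr)
        assume "i \<noteq> 0"
        have "{w i, w (j - 1)} \<in> T" using w(2)[of "j - 1"] ij by (simp add: insert_commute)
        then have "w (j - 1) = w (i - 1) \<or> w (j - 1) = w (Suc i)"
          using nbrs[of i] \<open>i \<noteq> 0\<close> ij by auto
        then have "j - 1 = i - 1 \<or> j - 1 = Suc i"
          using inj_onD[OF inj, of "j - 1" "i - 1"] inj_onD[OF inj, of "j - 1" "Suc i"] ij ij3 by auto
        then show False using ij3 \<open>i \<noteq> 0\<close> by auto
      qed
      \<comment> \<open>The closed walk is a cycle of length \<open>j \<le> 2 * l < k\<close>, so it
        cannot be odd; it is then an ear with equal ends.\<close>
      have "even j"
        using odd_cycle[OF cyc] k ij \<open>i = 0\<close> by auto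
      show False
      proof (rule no_ear[of j w])
        show "inj_on w {0<..<j}" using inj by (rule inj_on_subset) auto
        show "w 0 \<notin> w ` {0<..<j}" using ij by (auto dest: inj_onD[OF inj])
        then show "w j \<notin> w ` {0<..<j}" using ij \<open>i = 0\<close> by simp
      qed (use w nbrs ij ij3 \<open>i = 0\<close> \<open>even j\<close> in auto)
    qed
    then show ?thesis ..
  qed
qed

text \<open>Degrees above 2 create the excess of edges over vertices, and the layers bound the total
  degree by \<open>9 ^ l\<close> times the degree sum of the vertices of degree at least 3.\<close>

lemma card_edges_ge: "(3 * 9 ^ l + 1) * card S \<le> 3 * 9 ^ l * card T"
proof -
  let ?d = "\<lambda>x. card {y. {x, y} \<in> T}" and ?D = "layer S T 0"
  have "layer S T (2 * l) = S" using vertex_in_layer layer_subset[of S T "2 * l"] by auto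
  then have A: "2 * card T \<le> 9 ^ l * sum ?d ?D"
    using volume_layer_le[OF fin T, of "2 * l"] sum_degrees[OF fin T]
    by (simp only: power_mult) simp
  \<comment> \<open>Pointwise, \<open>3 * d \<ge> d + 6\<close> for \<open>d \<ge> 3\<close>, and
    \<open>3 * d \<ge> 6\<close> for \<open>d = 2\<close>.\<close>
  have "(\<Sum>x\<in>S. (if x \<in> ?D then ?d x else 0) + 6) \<le> (\<Sum>x\<in>S. 3 * ?d x)"
    by (rule sum_mono) (use degree_ge_2 in auto)
  moreover have "(\<Sum>x\<in>S. if x \<in> ?D then ?d x else 0) = sum ?d ?D"
    using fin by (auto simp: sum.If_cases intro!: sum.cong)
  ultimately have B: "sum ?d ?D + 6 * card S \<le> 6 * card T"
    using sum_degrees[OF fin T] by (simp add: sum.distrib sum_distrib_left[symmetric])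
  then have "card S \<le> card T" by linarith
  have "9 ^ l * (sum ?d ?D + 6 * card S) \<le> 9 ^ l * (6 * card T)"
    using B by (rule mult_le_mono2)
  then have "2 * card T + 9 ^ l * (6 * card S) \<le> 9 ^ l * (6 * card T)"
    using A by (simp add: algebra_simps)
  then show ?thesis using \<open>card S \<le> card T\<close> by (simp add: algebra_simps)
qed

end

text \<open>An uncolourable vertex set of least cardinality induces a critical graph, which is dense
  by \<open>card_edges_ge\<close>.\<close>

lemma dense_subgraph:
  fixes V :: "'a set"
  assumes "0 < l" "finite V" "E \<subseteq> vertex_pairs V"
    and cyc: "\<And>c. is_cycle (V, E) c \<Longrightarrow> odd (length c) \<Longrightarrow> 2 * l + 1 \<le> length c"
    and uncol: "\<And>f. \<not> cyclic_colouring (2 * l + 1) V E f"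
  shows "\<exists>S T. S \<subseteq> V \<and> S \<noteq> {} \<and> T \<subseteq> E \<and> T \<subseteq> vertex_pairs S \<and>
    (3 * 9 ^ l + 1) * card S \<le> 3 * 9 ^ l * card T"
proof -
  let ?P = "\<lambda>S. S \<subseteq> V \<and> (\<forall>f. \<not> cyclic_colouring (2 * l + 1) S E f)"
  obtain S where S: "S \<subseteq> V" "\<And>f. \<not> cyclic_colouring (2 * l + 1) S E f"
    and least: "\<And>X. ?P X \<Longrightarrow> card S \<le> card X"
    using ex_has_least_nat[of ?P V card] uncol by blast
  define T where "T = {e \<in> E. e \<subseteq> S}"
  have finS: "finite S" using finite_subset[OF S(1) assms(2)] .
  have T: "T \<subseteq> vertex_pairs S" using assms(3) by (auto simp: T_def vertex_pairs_def)
  have colour_iff: "cyclic_colouring k X T f \<longleftrightarrow> cyclic_colouring k X E f" if "X \<subseteq> S" for k X f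
    using that by (auto simp: cyclic_colouring_def T_def)
  interpret critical_graph l "2 * l + 1" S T
  proof
    show "2 * l + 1 \<le> length c" if "is_cycle (S, T) c" "odd (length c)" for c
      by (rule cyc) (use that S(1) in \<open>auto simp: is_cycle_iff T_def\<close>)
    show "\<not> cyclic_colouring (2 * l + 1) S T f" for f using S colour_iff by blast
    show "\<exists>f. cyclic_colouring (2 * l + 1) X T f" if "X \<subset> S" for X
      using least[of X] psubset_card_mono[OF finS that] that S(1) colour_iff[of X] by fastforce
  qed (use assms(1) finS T in auto)
  have "S \<noteq> {}" using S(2) by (auto simp: cyclic_colouring_def)
  then show ?thesis using S(1) T card_edges_ge by (intro exI[of _ S] exI[of _ T]) (auto simp: T_def)
qed

subsection \<open>Small dense subgraphs\<close>

text \<open>A crude Stirling bound: in the induction step the factor \<open>(1 + 1 / s) ^ s\<close>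
  is at most \<open>exp 1\<close>, hence at most 3.\<close>

lemma power_self_le_fact: "real s ^ s \<le> 3 ^ s * fact s"
proof (induction s)
  case (Suc s)
  have step: "real (Suc s) ^ s \<le> 3 * real s ^ s"
  proof (cases "s = 0")
    case False
    have "(1 + 1 / real s) ^ s \<le> 3"
      using exp_ge_one_plus_x_over_n_power_n[of s 1] exp_le False by simp
    then have "real s ^ s * (1 + 1 / real s) ^ s \<le> real s ^ s * 3" by (rule mult_left_mono) simp
    then show ?thesis using False by (simp add: power_mult_distrib[symmetric] distrib_left add.commute mult.commute)
  qed simp
  have "real (Suc s) ^ Suc s \<le> real (Suc s) * (3 * real s ^ s)"
    using step by (simp add: mult_left_mono del: of_nat_Suc)
  also have "\<dots> \<le> real (Suc s) * (3 * (3 ^ s * fact s))"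
    using Suc by (intro mult_left_mono) auto
  finally show ?case by (simp add: algebra_simps)
qed simp

lemma binomial_le_power_div:
  assumes "0 < s"
  shows "real (n choose s) \<le> (3 * real n / real s) ^ s"
proof -
  have "real (n choose s) * real s ^ s \<le> real (n choose s) * (3 ^ s * fact s)"
    by (intro mult_left_mono power_self_le_fact) simp
  also have "\<dots> = 3 ^ s * real ((n choose s) * fact s)" by simp
  also have "\<dots> \<le> 3 ^ s * real (n ^ s)"
    by (intro mult_left_mono) (simp_all only: of_nat_le_iff binomial_fact_pow, simp)
  finally show ?thesis using assms by (simp add: field_simps power_divide power_mult_distrib)
qed

text \<open>The expected number of pairs with \<open>s\<close> vertices and \<open>s + j\<close>
  edges. The binomial bounds leave \<open>9 ^ s\<close> for the first \<open>s\<close> edges and a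
  factor of order \<open>s / n\<close> for each of the \<open>j\<close> excess edges;
  \<open>s \<le> K * j\<close> lets the latter absorb \<open>9 ^ s\<close>.\<close>

lemma dense_pair_term:
  fixes p :: real
  assumes "0 < s" "0 < n" "0 \<le> p" "p \<le> 2 / real n" "s \<le> K * j"
  shows "real (n choose s) * real ((s choose 2) choose (s + j)) * p ^ (s + j)
    \<le> (3 * 9 ^ K * real s / real n) ^ j"
proof -
  let ?t = "s + j"
  have "2 * (s choose 2) \<le> s * s"
    by (cases s) (simp_all add: choose_two)
  then have "real (2 * (s choose 2)) \<le> real (s * s)" by (simp only: of_nat_le_iff)
  then have "real (s choose 2) \<le> real s * real s / 2" by simp
  then have "3 * real (s choose 2) / real ?t \<le> 3 * (real s * real s / 2) / real s"
    using assms(1) by (intro frac_le mult_left_mono) auto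
  then have "(3 * real (s choose 2) / real ?t) ^ ?t \<le> (3 * real s / 2) ^ ?t"
    using assms(1) by (intro power_mono) auto
  then have B: "real ((s choose 2) choose ?t) \<le> (3 * real s / 2) ^ ?t"
    using binomial_le_power_div[of ?t "s choose 2"] assms(1) by (meson add_gr_0 order_trans)
  have "real (n choose s) * real ((s choose 2) choose ?t) * p ^ ?t
      \<le> (3 * real n / real s) ^ s * (3 * real s / 2) ^ ?t * (2 / real n) ^ ?t"
    using assms B binomial_le_power_div[of s n] by (intro mult_mono power_mono) auto
  also have "\<dots> = (3 * real n / real s) ^ s * (3 * real s / real n) ^ ?t"
    by (simp add: mult.assoc power_mult_distrib[symmetric])
  also have "\<dots> = 9 ^ s * (3 * real s / real n) ^ j"
  proof -
    have "(3 * real n / real s) ^ s * (3 * real s / real n) ^ s = 9 ^ s"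
      using assms(1,2) by (simp add: power_mult_distrib[symmetric])
    then show ?thesis by (simp add: power_add)
  qed
  also have "\<dots> \<le> 9 ^ (K * j) * (3 * real s / real n) ^ j"
    using assms(5) by (intro mult_right_mono power_increasing) auto
  also have "\<dots> = (3 * 9 ^ K * real s / real n) ^ j"
    by (simp add: power_mult power_mult_distrib power_divide)
  finally show ?thesis .
qed

text \<open>Blocks of \<open>K\<close> consecutive indices share a quotient, which leaves
  \<open>K\<close> times a geometric series.\<close>

lemma sum_power_div_le:
  assumes "0 < K"
  shows "(\<Sum>s<n * K. (1 / 2 :: real) ^ (s div K)) \<le> 2 * real K"
proof -
  have "(\<Sum>s<n * K. (1 / 2 :: real) ^ (s div K)) = (\<Sum>i<n. \<Sum>s\<in>{i * K..<i * K + K}. (1 / 2) ^ (s div K))"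
    by (rule sum.nat_group[symmetric])
  also have "\<dots> = (\<Sum>i<n. real K * (1 / 2) ^ i)"
  proof (rule sum.cong[OF refl])
    fix i
    have "s div K = i" if "s \<in> {i * K..<i * K + K}" for s
      using that by (intro div_nat_eqI) (auto simp: algebra_simps)
    then show "(\<Sum>s\<in>{i * K..<i * K + K}. (1 / 2 :: real) ^ (s div K)) = real K * (1 / 2) ^ i" by simp
  qed
  also have "\<dots> = real K * (\<Sum>i<n. (1 / 2) ^ i)" by (simp add: sum_distrib_left)
  also have "\<dots> \<le> real K * 2"
    by (intro mult_left_mono) (auto simp: sum_gp_strict)
  finally show ?thesis by simp
qed

section \<open>Union bound for dense subgraphs of the random graph\<close>

lemma prob_edges_present_le:
  fixes p :: real
  assumes "finite A" "0 \<le> p" "p \<le> 1"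
  shows "measure_pmf.prob (Pi_pmf A False (\<lambda>_. bernoulli_pmf p)) {b. T \<subseteq> {e \<in> A. b e}} \<le> p ^ card T"
proof (cases "T \<subseteq> A")
  case True
  have "{b. T \<subseteq> {e \<in> A. b e}} = Pi A (\<lambda>e. if e \<in> T then {True} else UNIV)"
    using True by (auto simp: Pi_def split: if_splits)
  then have "measure_pmf.prob (Pi_pmf A False (\<lambda>_. bernoulli_pmf p)) {b. T \<subseteq> {e \<in> A. b e}}
     = (\<Prod>e\<in>A. measure_pmf.prob (bernoulli_pmf p) (if e \<in> T then {True} else UNIV))"
    by (simp add: measure_Pi_pmf_Pi[OF assms(1)])
  also have "\<dots> = (\<Prod>e\<in>A. if e \<in> T then p else 1)"
    using assms by (intro prod.cong refl) (auto simp: measure_pmf_single)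
  also have "\<dots> = p ^ card T"
    using True assms(1) by (simp add: prod.If_cases Int_absorb1)
  finally show ?thesis by simp
\<comment> \<open>A set of edges not contained in \<open>A\<close> is never present, which is why
  the bound is only an inequality.\<close>
next
  case False
  then have "{b. T \<subseteq> {e \<in> A. b e}} = {}" by auto
  then show ?thesis using assms by simp
qed

lemma prob_dense_pair_le:
  fixes p :: real
  assumes "finite V" "0 \<le> p" "p \<le> 1"
  shows "measure_pmf.prob (Pi_pmf (vertex_pairs V) False (\<lambda>_. bernoulli_pmf p))
      {b. \<exists>S T. S \<subseteq> V \<and> card S = s \<and> T \<subseteq> vertex_pairs S \<and> card T = t \<and> T \<subseteq> {e \<in> vertex_pairs V. b e}}
    \<le> real (card V choose s) * real ((s choose 2) choose t) * p ^ t"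
proof -
  let ?M = "Pi_pmf (vertex_pairs V) False (\<lambda>_. bernoulli_pmf p)"
  let ?B = "\<lambda>T. {b. T \<subseteq> {e \<in> vertex_pairs V. b e}}"
  let ?SS = "{S. S \<subseteq> V \<and> card S = s}" and ?TT = "\<lambda>S. {T. T \<subseteq> vertex_pairs S \<and> card T = t}"
  define I where "I = (SIGMA S:?SS. ?TT S)"
  have finS: "finite S" if "S \<in> ?SS" for S using that assms(1) by (auto intro: finite_subset)
  have card_TT: "card (?TT S) = (s choose 2) choose t" if "S \<in> ?SS" for S
    using n_subsets[OF finite_vertex_pairs[OF finS[OF that]], of t] n_subsets[OF finS[OF that], of 2] that
    by (simp add: vertex_pairs_def)
  have finI: "finite I" unfolding I_def
    using assms(1) finite_vertex_pairs[OF finS] by (intro finite_SigmaI) auto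
  have cardI: "card I = (card V choose s) * ((s choose 2) choose t)"
  proof -
    have "card I = (\<Sum>S\<in>?SS. card (?TT S))" unfolding I_def
      using assms(1) finite_vertex_pairs[OF finS] by (intro card_SigmaI) auto
    also have "\<dots> = (\<Sum>S\<in>?SS. (s choose 2) choose t)" using card_TT by (intro sum.cong refl)
    finally show ?thesis using n_subsets[OF assms(1), of s] by simp
  qed
  have "{b. \<exists>S T. S \<subseteq> V \<and> card S = s \<and> T \<subseteq> vertex_pairs S \<and> card T = t \<and> T \<subseteq> {e \<in> vertex_pairs V. b e}}
      \<subseteq> (\<Union>i\<in>I. ?B (snd i))" (is "?X \<subseteq> _")
  proof
    fix b assume "b \<in> ?X"
    then obtain S T where ST: "S \<in> ?SS" "T \<in> ?TT S" and b: "b \<in> ?B T" by auto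
    have "(S, T) \<in> I" unfolding I_def using ST by (rule SigmaI)
    then show "b \<in> (\<Union>i\<in>I. ?B (snd i))" using b by (intro UN_I[of "(S, T)"]) simp_all
  qed
  then have "measure_pmf.prob ?M ?X \<le> measure_pmf.prob ?M (\<Union>i\<in>I. ?B (snd i))"
    by (rule measure_pmf.finite_measure_mono) auto
  also have "\<dots> \<le> (\<Sum>i\<in>I. measure_pmf.prob ?M (?B (snd i)))"
    using finI by (intro measure_pmf.finite_measure_subadditive_finite) auto
  also have "\<dots> \<le> (\<Sum>i\<in>I. p ^ t)"
  proof (rule sum_mono)
    fix i assume "i \<in> I"
    then have "card (snd i) = t" by (auto simp: I_def)
    then show "measure_pmf.prob ?M (?B (snd i)) \<le> p ^ t"
      using prob_edges_present_le[OF finite_vertex_pairs[OF assms(1)] assms(2,3), of "snd i"] by simp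
  qed
  finally show ?thesis by (simp add: cardI)
qed

text \<open>For each size \<open>s\<close>, density forces an excess of at least
  \<open>s div K + 1\<close> edges. The union bound then decays geometrically in
  \<open>s div K\<close>, with a factor of order \<open>1 / n\<close> in front.\<close>

lemma prob_small_dense_le:
  fixes p :: real
  assumes "0 < M" "0 < n" "0 \<le> p" "p \<le> 2 / real n" "p \<le> 1" and K: "K = 2 * M"
  shows "measure_pmf.prob (Pi_pmf (vertex_pairs {1..n}) False (\<lambda>_. bernoulli_pmf p))
      {b. \<exists>S T. S \<subseteq> {1..n} \<and> S \<noteq> {} \<and> T \<subseteq> vertex_pairs S \<and> T \<subseteq> {e \<in> vertex_pairs {1..n}. b e} \<and>
         (M + 1) * card S \<le> M * card T \<and> 4 * (3 * 9 ^ K) * card S \<le> n}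
    \<le> 6 * 9 ^ K * real K ^ 2 / real n"
proof -
  let ?M = "Pi_pmf (vertex_pairs {1..n}) False (\<lambda>_. bernoulli_pmf p)"
  define A :: nat where "A = 3 * 9 ^ K"
  define B where "B s = {b. \<exists>S T. S \<subseteq> {1..n} \<and> card S = s \<and> T \<subseteq> vertex_pairs S \<and>
     card T = s + (s div K + 1) \<and> T \<subseteq> {e \<in> vertex_pairs {1..n}. b e}}" for s
  define I where "I = {s. 0 < s \<and> 4 * A * s \<le> n}"
  have "0 < K" "1 \<le> A" using assms by (auto simp: A_def)
  have I_sub: "I \<subseteq> {..<n * K}"
  proof
    fix s assume "s \<in> I"
    then have "0 < s" "4 * A * s \<le> n" by (auto simp: I_def)
    moreover have "4 * 1 * s \<le> 4 * A * s" using \<open>1 \<le> A\<close> by (intro mult_le_mono) auto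
    moreover have "n * 1 \<le> n * K" using \<open>0 < K\<close> by (intro mult_le_mono) auto
    ultimately have "s < n * K" using \<open>0 < s\<close> by linarith
    then show "s \<in> {..<n * K}" by simp
  qed
  have term_le: "measure_pmf.prob ?M (B s) \<le> real A * real K / real n * (1 / 2) ^ (s div K)" if "s \<in> I" for s
  proof -
    let ?i = "s div K"
    have s: "0 < s" "4 * A * s \<le> n" using that by (auto simp: I_def)
    have sK: "s \<le> K * (?i + 1)"
      using dividend_less_times_div[OF \<open>0 < K\<close>, of s] by simp
    have "measure_pmf.prob ?M (B s)
        \<le> real (n choose s) * real ((s choose 2) choose (s + (?i + 1))) * p ^ (s + (?i + 1))"
      using prob_dense_pair_le[of "{1..n}" p s "s + (?i + 1)"] assms unfolding B_def by simp
    also have "\<dots> \<le> (3 * 9 ^ K * real s / real n) ^ (?i + 1)"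
      by (rule dense_pair_term) (use s sK assms in auto)
    also have "\<dots> = (real A * real s / real n) * (real A * real s / real n) ^ ?i"
      by (simp add: A_def)
    \<comment> \<open>One factor is set aside to supply \<open>1 / n\<close>; the size restriction
      makes each of the others at most \<open>1 / 4\<close>.\<close>
    also have "\<dots> \<le> (real A * real s / real n) * (1 / 4) ^ ?i"
    proof -
      have "real (4 * A * s) \<le> real n" using s(2) by (simp only: of_nat_le_iff)
      then have "real A * real s / real n \<le> 1 / 4" using assms(2) by (simp add: field_simps)
      then show ?thesis by (intro mult_left_mono power_mono) auto
    qed
    \<comment> \<open>The remaining \<open>s\<close> costs at most \<open>K * 2 ^ ?i\<close>, which
      still leaves a decay of \<open>1 / 2\<close>.\<close>
    also have "\<dots> \<le> (real A * real (K * 2 ^ ?i) / real n) * (1 / 4) ^ ?i"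
    proof -
      have "?i + 1 \<le> 2 ^ ?i" by (simp add: Suc_le_eq)
      then have "K * (?i + 1) \<le> K * 2 ^ ?i" by (rule mult_le_mono2)
      then have "real s \<le> real (K * 2 ^ ?i)" using sK by (simp only: of_nat_le_iff)
      then show ?thesis by (intro mult_right_mono divide_right_mono mult_left_mono) auto
    qed
    also have "\<dots> = real A * real K / real n * (2 ^ ?i * (1 / 4) ^ ?i)" by simp
    also have "\<dots> = real A * real K / real n * (1 / 2) ^ ?i"
      by (simp add: power_mult_distrib[symmetric])
    finally show ?thesis .
  qed
  have "{b. \<exists>S T. S \<subseteq> {1..n} \<and> S \<noteq> {} \<and> T \<subseteq> vertex_pairs S \<and> T \<subseteq> {e \<in> vertex_pairs {1..n}. b e} \<and>
         (M + 1) * card S \<le> M * card T \<and> 4 * (3 * 9 ^ K) * card S \<le> n} \<subseteq> (\<Union>s\<in>I. B s)"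
  proof
    fix b assume "b \<in> {b. \<exists>S T. S \<subseteq> {1..n} \<and> S \<noteq> {} \<and> T \<subseteq> vertex_pairs S \<and>
      T \<subseteq> {e \<in> vertex_pairs {1..n}. b e} \<and> (M + 1) * card S \<le> M * card T \<and> 4 * (3 * 9 ^ K) * card S \<le> n}"
    then obtain S T where ST: "S \<subseteq> {1..n}" "S \<noteq> {}" "T \<subseteq> vertex_pairs S"
      "T \<subseteq> {e \<in> vertex_pairs {1..n}. b e}" "(M + 1) * card S \<le> M * card T" "4 * A * card S \<le> n"
      by (auto simp: A_def)
    let ?s = "card S"
    have "0 < ?s" using ST(1,2) by (meson card_gt_0_iff finite_atLeastAtMost finite_subset)
    \<comment> \<open>The excess is at least \<open>?s / M\<close>, and \<open>K = 2 * M\<close> leaves room for rounding.\<close>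
    have "?s + (?s div K + 1) \<le> card T"
    proof (rule ccontr)
      assume "\<not> ?thesis"
      then have "M * card T \<le> M * (?s + ?s div K)" by (intro mult_le_mono2) auto
      moreover have "K * (?s div K) \<le> ?s" by simp
      then have "2 * (M * (?s div K)) \<le> ?s" by (simp only: K mult.assoc)
      ultimately show False using ST(5) \<open>0 < ?s\<close> by (simp add: algebra_simps)
    qed
    \<comment> \<open>Surplus edges are discarded to reach the exact number counted in
      \<open>B\<close>.\<close>
    then obtain T' where "T' \<subseteq> T" "card T' = ?s + (?s div K + 1)"
      by (meson obtain_subset_with_card_n)
    then have "b \<in> B ?s" unfolding B_def using ST by blast
    then show "b \<in> (\<Union>s\<in>I. B s)" using ST(6) \<open>0 < ?s\<close> by (auto simp: I_def)
  qed
  then have "measure_pmf.prob ?M {b. \<exists>S T. S \<subseteq> {1..n} \<and> S \<noteq> {} \<and> T \<subseteq> vertex_pairs S \<and>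
      T \<subseteq> {e \<in> vertex_pairs {1..n}. b e} \<and> (M + 1) * card S \<le> M * card T \<and> 4 * (3 * 9 ^ K) * card S \<le> n}
      \<le> measure_pmf.prob ?M (\<Union>s\<in>I. B s)"
    by (rule measure_pmf.finite_measure_mono) auto
  also have "\<dots> \<le> (\<Sum>s\<in>I. measure_pmf.prob ?M (B s))"
    using finite_subset[OF I_sub] by (intro measure_pmf.finite_measure_subadditive_finite) auto
  also have "\<dots> \<le> (\<Sum>s\<in>I. real A * real K / real n * (1 / 2) ^ (s div K))"
    by (intro sum_mono term_le)
  also have "\<dots> \<le> (\<Sum>s<n * K. real A * real K / real n * (1 / 2) ^ (s div K))"
    by (rule sum_mono2) (use I_sub in auto)
  also have "\<dots> = real A * real K / real n * (\<Sum>s<n * K. (1 / 2) ^ (s div K))"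
    by (simp add: sum_distrib_left)
  also have "\<dots> \<le> real A * real K / real n * (2 * real K)"
    by (intro mult_left_mono sum_power_div_le \<open>0 < K\<close>) auto
  finally show ?thesis by (simp add: A_def power2_eq_square field_simps)
qed

subsection \<open>The weighted number of cycles\<close>

text \<open>Each cycle is counted once for every choice of starting vertex and orientation.\<close>

definition cycle_lists :: "nat \<Rightarrow> nat list set" where
  "cycle_lists n = {c. set c \<subseteq> {1..n} \<and> distinct c \<and> 3 \<le> length c}"

lemma finite_cycle_lists: "finite (cycle_lists n)"
  by (rule finite_subset[OF _ finite_subset_distinct[of "{1..n}"]]) (auto simp: cycle_lists_def)

definition cycle_weight :: "nat \<Rightarrow> real \<Rightarrow> nat set set \<Rightarrow> real" where
  "cycle_weight n \<theta> E = (\<Sum>c\<in>cycle_lists n. \<theta> ^ length c * of_bool (cycle_edges c \<subseteq> E))"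

text \<open>There are at most \<open>n ^ j\<close> lists of length \<open>j\<close>, so a geometric
  series dominates the sum.\<close>

lemma sum_cycle_lists_le:
  fixes x :: real
  assumes "0 \<le> x" "real n * x < 1"
  shows "(\<Sum>c\<in>cycle_lists n. x ^ length c) \<le> 1 / (1 - real n * x)"
proof -
  let ?L = "\<lambda>j. {c. set c \<subseteq> {1..n} \<and> length c = j}"
  have finL: "finite (?L j)" for j by (rule finite_lists_length_eq) simp
  have "cycle_lists n \<subseteq> (\<Union>j\<in>{..n}. ?L j)"
  proof
    fix c assume "c \<in> cycle_lists n"
    then have c: "set c \<subseteq> {1..n}" "distinct c" by (auto simp: cycle_lists_def)
    then have "length c \<le> n" using card_mono[OF _ c(1)] distinct_card[OF c(2)] by simp
    then show "c \<in> (\<Union>j\<in>{..n}. ?L j)" using c by auto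
  qed
  then have "(\<Sum>c\<in>cycle_lists n. x ^ length c) \<le> (\<Sum>c\<in>(\<Union>j\<in>{..n}. ?L j). x ^ length c)"
    using finL assms(1) by (intro sum_mono2) auto
  also have "\<dots> = (\<Sum>j\<le>n. \<Sum>c\<in>?L j. x ^ length c)"
    using finL by (intro sum.UNION_disjoint) auto
  also have "\<dots> = (\<Sum>j\<le>n. (real n * x) ^ j)"
    by (intro sum.cong refl) (simp add: card_lists_length_eq power_mult_distrib)
  also have "\<dots> \<le> (\<Sum>j. (real n * x) ^ j)"
    using assms by (intro sum_le_suminf summable_geometric) auto
  also have "\<dots> = 1 / (1 - real n * x)" using assms by (intro suminf_geometric) auto
  finally show ?thesis .
qed

text \<open>A cycle of length \<open>j\<close> has \<open>j\<close> distinct edges and contributes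
  at most \<open>(p * \<theta>) ^ j\<close> to the expectation; Markov's inequality does the
  rest.\<close>

lemma prob_cycle_weight_ge:
  fixes p \<theta> a :: real
  assumes "0 \<le> p" "p \<le> 1" "0 \<le> \<theta>" "real n * (p * \<theta>) < 1" "0 < a"
  shows "measure_pmf.prob (Pi_pmf (vertex_pairs {1..n}) False (\<lambda>_. bernoulli_pmf p))
      {b. a \<le> cycle_weight n \<theta> {e \<in> vertex_pairs {1..n}. b e}}
    \<le> 1 / (1 - real n * (p * \<theta>)) / a"
proof -
  let ?M = "Pi_pmf (vertex_pairs {1..n}) False (\<lambda>_. bernoulli_pmf p)"
  let ?B = "\<lambda>c. {b. cycle_edges c \<subseteq> {e \<in> vertex_pairs {1..n}. b e}}"
  let ?W = "\<lambda>b. cycle_weight n \<theta> {e \<in> vertex_pairs {1..n}. b e}"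
  have W: "?W b = (\<Sum>c\<in>cycle_lists n. \<theta> ^ length c * indicator (?B c) b)" for b
    unfolding cycle_weight_def by (intro sum.cong refl) (simp add: indicator_def)
  have int: "integrable ?M (\<lambda>b. \<theta> ^ length c * indicator (?B c) b)" for c
    by (intro integrable_mult_right integrable_real_indicator) (simp_all add: measure_pmf.emeasure_finite less_top[symmetric])
  have "measure_pmf.expectation ?M ?W
      = (\<Sum>c\<in>cycle_lists n. \<theta> ^ length c * measure_pmf.prob ?M (?B c))"
    unfolding W using int by simp
  also have "\<dots> \<le> (\<Sum>c\<in>cycle_lists n. (p * \<theta>) ^ length c)"
  proof (rule sum_mono)
    fix c assume "c \<in> cycle_lists n"
    then have "card (cycle_edges c) = length c" by (auto simp: cycle_lists_def card_cycle_edges)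
    then have "measure_pmf.prob ?M (?B c) \<le> p ^ length c"
      using prob_edges_present_le[OF finite_vertex_pairs assms(1,2), of "{1..n}" "cycle_edges c"] by simp
    then show "\<theta> ^ length c * measure_pmf.prob ?M (?B c) \<le> (p * \<theta>) ^ length c"
      using assms(3) by (simp add: power_mult_distrib mult.commute mult_left_mono)
  qed
  also have "\<dots> \<le> 1 / (1 - real n * (p * \<theta>))"
    using assms by (intro sum_cycle_lists_le) auto
  finally have E: "measure_pmf.expectation ?M ?W \<le> 1 / (1 - real n * (p * \<theta>))" .
  have "measure_pmf.prob ?M {b \<in> space (measure_pmf ?M). a \<le> ?W b} \<le> measure_pmf.expectation ?M ?W / a"
  proof (rule integral_Markov_inequality_measure)
    show "integrable ?M ?W" unfolding W using int by simp
    show "AE b in ?M. 0 \<le> ?W b" using assms(3) by (simp add: cycle_weight_def sum_nonneg)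
  qed (use assms(5) in auto)
  also have "\<dots> \<le> 1 / (1 - real n * (p * \<theta>)) / a"
    using E assms(5) by (intro divide_right_mono) auto
  finally show ?thesis by simp
qed

text \<open>The choice of \<open>\<theta>\<close> gives
  \<open>\<theta> * (1 + 1 / M) = 1 + 1 / (2 * M)\<close>, so at least
  \<open>card S / (2 * M)\<close> of the weighted edge count must come from cycles.\<close>

lemma cycle_weight_ge:
  fixes M :: nat
  assumes "0 < M" "S \<subseteq> {1..n}" "T \<subseteq> vertex_pairs S" "T \<subseteq> E"
    and "(M + 1) * card S \<le> M * card T" and \<theta>: "\<theta> = (2 * real M + 1) / (2 * real M + 2)"
  shows "real (card S) / (2 * real M) \<le> cycle_weight n \<theta> E"
proof -
  have \<theta>01: "0 \<le> \<theta>" "\<theta> \<le> 1" unfolding \<theta> by simp_all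
  have finS: "finite S" using assms(2) by (rule finite_subset) simp
  have "real ((M + 1) * card S) \<le> real (M * card T)" using assms(5) by (simp only: of_nat_le_iff)
  then have "(real M + 1) / real M * real (card S) \<le> real (card T)"
    using assms(1) by (simp add: field_simps)
  then have "\<theta> * ((real M + 1) / real M * real (card S)) \<le> \<theta> * real (card T)"
    using \<theta>01(1) by (rule mult_left_mono)
  moreover have "\<theta> * ((real M + 1) / real M * real (card S)) = real (card S) + real (card S) / (2 * real M)"
  proof -
    have "2 * real M + 2 \<noteq> 0" "real M \<noteq> 0" using assms(1) by auto
    then show ?thesis unfolding \<theta> by (simp add: divide_simps) (simp add: algebra_simps)
  qed
  moreover have "\<theta> * real (card T) \<le> real (card S) +
      (\<Sum>c\<in>{c \<in> cycle_lists n. cycle_edges c \<subseteq> T}. \<theta> ^ card (cycle_edges c))"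
    by (rule weighted_cycle_bound[OF finS assms(3) finite_cycle_lists _ \<theta>01])
      (use assms(2) in \<open>auto simp: is_cycle_iff cycle_lists_def\<close>)
  moreover have "(\<Sum>c\<in>{c \<in> cycle_lists n. cycle_edges c \<subseteq> T}. \<theta> ^ card (cycle_edges c))
      \<le> cycle_weight n \<theta> E"
  proof -
    have "(\<Sum>c\<in>{c \<in> cycle_lists n. cycle_edges c \<subseteq> T}. \<theta> ^ card (cycle_edges c))
        = (\<Sum>c\<in>{c \<in> cycle_lists n. cycle_edges c \<subseteq> T}. \<theta> ^ length c * of_bool (cycle_edges c \<subseteq> E))"
      using assms(4) by (intro sum.cong refl) (auto simp: cycle_lists_def card_cycle_edges)
    also have "\<dots> \<le> cycle_weight n \<theta> E"
      unfolding cycle_weight_def using \<theta>01(1) finite_cycle_lists by (intro sum_mono2) auto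
    finally show ?thesis .
  qed
  ultimately show ?thesis by linarith
qed

section \<open>Choice of constants and combination of the two error bounds\<close>

theorem theorem1:
  fixes l :: nat
  assumes "l > 1"
  shows "\<exists>\<epsilon>::real. \<epsilon> > 0 \<and>
    (\<lambda>n. measure_pmf.prob (erdos_renyi n ((1 + \<epsilon>) / real n))
       {G. odd_girth G < enat (2 * l + 1) \<or> (\<exists>f. graph_hom G (cycle_graph (2 * l + 1)) f)})
    \<longlonglongrightarrow> 1"
proof -
  \<comment> \<open>\<open>M\<close> comes from the density bound; \<open>A * card S \<le> n\<close>
    separates small sets from large ones. This \<open>A\<close> includes the factor 4 of
    \<open>prob_small_dense_le\<close>.\<close>
  define M K A :: nat where "M = 3 * 9 ^ l" and "K = 2 * M" and "A = 4 * (3 * 9 ^ K)"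
  \<comment> \<open>\<open>\<epsilon>\<close> is small enough for \<open>\<rho> < 1\<close>, where
    \<open>\<rho>\<close> is the ratio \<open>n * p * \<theta>\<close> of the geometric
    series.\<close>
  define \<epsilon> \<theta> \<rho> :: real where "\<epsilon> = 1 / (4 * real M)" and "\<theta> = (2 * real M + 1) / (2 * real M + 2)"
    and "\<rho> = (1 + \<epsilon>) * \<theta>"
  define C :: real where "C = 6 * 9 ^ K * real K ^ 2 + 1 / (1 - \<rho>) * (2 * real M * real A)"
  let ?good = "{G. odd_girth G < enat (2 * l + 1) \<or> (\<exists>f. graph_hom G (cycle_graph (2 * l + 1)) f)}
    :: nat graph set"
  have "1 \<le> M" "0 < A" by (simp_all add: M_def A_def)
  then have "0 < \<epsilon>" "\<epsilon> \<le> 1" "0 \<le> \<theta>" by (simp_all add: \<epsilon>_def \<theta>_def)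
  have "\<rho> = (8 * real M ^ 2 + 6 * real M + 1) / (8 * real M ^ 2 + 8 * real M)"
  proof -
    have "2 * real M + 2 \<noteq> 0" "real M \<noteq> 0" "8 * real M ^ 2 + 8 * real M > 0"
      using \<open>1 \<le> M\<close> by (auto intro: add_pos_pos)
    then show ?thesis unfolding \<rho>_def \<epsilon>_def \<theta>_def
      by (simp add: divide_simps) (simp add: algebra_simps power2_eq_square)
  qed
  also have "\<dots> < 1" using \<open>1 \<le> M\<close> by (simp add: add_pos_pos)
  finally have "\<rho> < 1" .
  have bound: "1 - C / real n \<le> measure_pmf.prob (erdos_renyi n ((1 + \<epsilon>) / real n)) ?good"
    if n: "2 \<le> n" for n
  proof -
    define p where "p = (1 + \<epsilon>) / real n"
    \<comment> \<open>From \<open>n \<ge> 2\<close> and \<open>\<epsilon> \<le> 1\<close>; thus the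
      truncation in \<open>bernoulli_pmf\<close> does not take effect.\<close>
    have p: "0 \<le> p" "p \<le> 1" "p \<le> 2 / real n"
      using n \<open>0 < \<epsilon>\<close> \<open>\<epsilon> \<le> 1\<close> by (auto simp: p_def divide_simps)
    have np: "real n * (p * \<theta>) = \<rho>" using n by (simp add: p_def \<rho>_def)
    let ?M = "Pi_pmf (vertex_pairs {1..n}) False (\<lambda>_. bernoulli_pmf p)"
    let ?E = "\<lambda>b. {e \<in> vertex_pairs {1..n}. b e}"
    define X where "X = {b. \<exists>S T. S \<subseteq> {1..n} \<and> S \<noteq> {} \<and> T \<subseteq> vertex_pairs S \<and> T \<subseteq> ?E b \<and>
         (M + 1) * card S \<le> M * card T \<and> A * card S \<le> n}"
    \<comment> \<open>The cycle weight guaranteed by a dense pair with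
      \<open>card S > n / A\<close>.\<close>
    define a where "a = real n / (2 * real M * real A)"
    define Y where "Y = {b. a \<le> cycle_weight n \<theta> (?E b)}"
    let ?G = "{b. ({1..n}, ?E b) \<in> ?good}"
    have "0 < a" using n \<open>1 \<le> M\<close> \<open>0 < A\<close> by (simp add: a_def)
    have "- ?G \<subseteq> X \<union> Y"
    proof
      fix b assume "b \<in> - ?G"
      then have girth: "\<not> odd_girth ({1..n}, ?E b) < enat (2 * l + 1)"
        and hom: "\<And>f. \<not> graph_hom ({1..n}, ?E b) (cycle_graph (2 * l + 1)) f" by auto
      have "\<exists>S T. S \<subseteq> {1..n} \<and> S \<noteq> {} \<and> T \<subseteq> ?E b \<and> T \<subseteq> vertex_pairs S \<and>
          (3 * 9 ^ l + 1) * card S \<le> 3 * 9 ^ l * card T"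
      proof (rule dense_subgraph)
        fix c assume c: "is_cycle ({1..n}, ?E b) c" "odd (length c)"
        then have "odd_girth ({1..n}, ?E b) \<le> enat (length c)"
          unfolding odd_girth_def by (intro INF_lower) auto
        with girth have "enat (2 * l + 1) \<le> enat (length c)" by (meson not_less order_trans)
        then show "2 * l + 1 \<le> length c" by simp
      next
        fix f
        show "\<not> cyclic_colouring (2 * l + 1) {1..n} (?E b) f"
        proof
          assume "cyclic_colouring (2 * l + 1) {1..n} (?E b) f"
          then have "graph_hom ({1..n}, ?E b) (cycle_graph (2 * l + 1))
              (\<lambda>x. nat (f x mod int (2 * l + 1)))"
            by (rule graph_hom_cycle_graph[rotated]) simp
          then show False using hom by contradiction
        qed
      qed (use assms in auto)
      then obtain S T where ST: "S \<subseteq> {1..n}" "S \<noteq> {}" "T \<subseteq> ?E b" "T \<subseteq> vertex_pairs S"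
        "(M + 1) * card S \<le> M * card T" unfolding M_def by blast
      show "b \<in> X \<union> Y"
      proof (cases "A * card S \<le> n")
        case True
        then show ?thesis using ST unfolding X_def by blast
      next
        case False
        then have "real n \<le> real (A * card S)" by (simp only: of_nat_le_iff)
        then have "a \<le> real (card S) / (2 * real M)"
          using \<open>0 < A\<close> \<open>1 \<le> M\<close> by (simp add: a_def field_simps)
        also have "\<dots> \<le> cycle_weight n \<theta> (?E b)"
          using \<open>1 \<le> M\<close> by (intro cycle_weight_ge[OF _ ST(1,4,3,5) \<theta>_def]) simp
        finally show ?thesis by (simp add: Y_def)
      qed
    qed
    then have "measure_pmf.prob ?M (- ?G) \<le> measure_pmf.prob ?M (X \<union> Y)"
      by (rule measure_pmf.finite_measure_mono) simp
    also have "\<dots> \<le> measure_pmf.prob ?M X + measure_pmf.prob ?M Y"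
      by (rule measure_Un_le) simp_all
    also have "\<dots> \<le> 6 * 9 ^ K * real K ^ 2 / real n + 1 / (1 - \<rho>) / a"
    proof (rule add_mono)
      show "measure_pmf.prob ?M X \<le> 6 * 9 ^ K * real K ^ 2 / real n"
        using prob_small_dense_le[of M n p K] p n \<open>1 \<le> M\<close> K_def unfolding X_def A_def by simp
      show "measure_pmf.prob ?M Y \<le> 1 / (1 - \<rho>) / a"
        using prob_cycle_weight_ge[of p \<theta> n a] p \<open>0 \<le> \<theta>\<close> \<open>0 < a\<close> \<open>\<rho> < 1\<close>
        unfolding Y_def np by simp
    qed
    also have "\<dots> = C / real n" by (simp add: C_def a_def add_divide_distrib)
    finally have "1 - C / real n \<le> measure_pmf.prob ?M ?G"
      using measure_pmf.prob_compl[of ?G ?M] by (simp add: Compl_eq_Diff_UNIV)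
    then show ?thesis by (simp add: erdos_renyi_def p_def vimage_def)
  qed
  have "(\<lambda>n. measure_pmf.prob (erdos_renyi n ((1 + \<epsilon>) / real n)) ?good) \<longlonglongrightarrow> 1"
  proof (rule tendsto_sandwich)
    show "(\<lambda>n. 1 - C / real n) \<longlonglongrightarrow> 1"
      using tendsto_diff[OF tendsto_const lim_const_over_n[of C], of 1] by simp
    show "\<forall>\<^sub>F n in sequentially. 1 - C / real n \<le>
        measure_pmf.prob (erdos_renyi n ((1 + \<epsilon>) / real n)) ?good"
      using eventually_ge_at_top[of 2] by (rule eventually_mono) (rule bound)
  qed auto
  with \<open>0 < \<epsilon>\<close> show ?thesis by blast
qed

end
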